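(* Let $\alpha,\beta,\gamma$ be parameters with $\alpha\beta\ne0$ and $4\alpha\beta\neq\gamma^2$, and set $$\delta=\sqrt{4\alpha\beta-\gamma^2},\qquad \theta=\arctan(\gamma/\delta).$$ The generating function of all labelled diagrams associated with $\alpha D^2+\beta X^2+\gamma XD$ is $$G(z;u,v)=\exp\left(\left(\frac{u^2}{4\alpha}+\frac{v^2}{4\beta}\right)\bigl(\delta\tan(\delta z+\theta)-\gamma\bigr)\right)\cdot\exp\left(uv\left(\frac{\cos\theta}{\cos(\delta z+\theta)}-1\right)\right)\cdot e^{-\frac{\gamma}{2}z}\sqrt{\frac{\cos\theta}{\cos(\delta z+\theta)}} .$$
   Context: Labelled diagrams associated with $\alpha D^2+\beta X^2+\gamma XD$: a labelled diagram of size $n$ has inner nodes (gates) labelled $1,\dots,n$, each being a $D^2$-gate (two ordered input slots, no output slot; weight $\alpha$), an $X^2$-gate (two ordered output slots, no input slot; weight $\beta$), or an $XD$-gate (one input slot and one output slot; weight $\gamma$), together with a set of connections, each joining an output slot of a node $i$ to an input slot of a node $j$ with $i<j$, every slot being used at most once. Slots of a node are distinguishable. Unconnected output slots are the outputs, unconnected input slots the inputs. Diagrams need not be connected. The weight of a diagram is the product of the weights of its gates. $G(z;u,v)=\sum_{n,a,b} c_{n,a,b}\,u^av^b\,\frac{z^n}{n!}$, where $c_{n,a,b}$ is the total weight of labelled diagrams of size $n$ with $a$ outputs and $b$ inputs. (Equivalently, $c_{n,a,b}$ is the coefficient of $X^aD^b$ in the normal form of $(\alpha D^2+\beta X^2+\gamma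 XD)^n$ when $DX-XD=1$.) The parameters may be regarded as complex numbers or as formal indeterminates (working in a suitable extension containing $\delta$); the identity is one of formal power series in $z$, with expansions at $z=0$ using $\tan\theta=\gamma/\delta$, and with the branch of the final square root equal to $1$ at $z=0$. *)

theory Defs
  imports "HOL-Complex_Analysis.Complex_Analysis" "HOL-Library.FuncSet"
begin

datatype gate = D2 | X2 | XD

fun num_in :: "gate \<Rightarrow> nat" where
  "num_in D2 = 2" | "num_in X2 = 0" | "num_in XD = 1"

fun num_out :: "gate \<Rightarrow> nat" where
  "num_out D2 = 0" | "num_out X2 = 2" | "num_out XD = 1"

fun gate_weight :: "complex \<Rightarrow> complex \<Rightarrow> complex \<Rightarrow> gate \<Rightarrow> complex" where
  "gate_weight \<alpha> \<beta> \<gamma> D2 = \<alpha>"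
| "gate_weight \<alpha> \<beta> \<gamma> X2 = \<beta>"
| "gate_weight \<alpha> \<beta> \<gamma> XD = \<gamma>"

text \<open>A slot is a pair of a node label and the position of the slot at that node, so that
  the slots of a node are distinguishable.\<close>

type_synonym slot = "nat \<times> nat"

definition in_slots :: "nat \<Rightarrow> (nat \<Rightarrow> gate) \<Rightarrow> slot set" where
  "in_slots n g = (SIGMA j:{1..n}. {..<num_in (g j)})"

definition out_slots :: "nat \<Rightarrow> (nat \<Rightarrow> gate) \<Rightarrow> slot set" where
  "out_slots n g = (SIGMA i:{1..n}. {..<num_out (g i)})"

text \<open>A diagram is a gate assignment together with a set of connections
  (output slot, input slot). Injectivity of the projections says that every slot is used at
  most once; the extensional function space makes the gate assignment determined by its values
  on \<open>{1..n}\<close>, so that diagrams are not counted repeatedly.\<close>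

type_synonym diagram = "(nat \<Rightarrow> gate) \<times> (slot \<times> slot) set"

definition labelled_diagrams :: "nat \<Rightarrow> diagram set" where
  "labelled_diagrams n =
     {(g, C). g \<in> {1..n} \<rightarrow>\<^sub>E UNIV \<and>
              C \<subseteq> out_slots n g \<times> in_slots n g \<and>
              (\<forall>(p, q)\<in>C. fst p < fst q) \<and>
              inj_on fst C \<and> inj_on snd C}"

definition diagram_outputs :: "nat \<Rightarrow> diagram \<Rightarrow> slot set" where
  "diagram_outputs n d = out_slots n (fst d) - fst ` snd d"

definition diagram_inputs :: "nat \<Rightarrow> diagram \<Rightarrow> slot set" where
  "diagram_inputs n d = in_slots n (fst d) - snd ` snd d"

definition diagram_weight ::
    "complex \<Rightarrow> complex \<Rightarrow> complex \<Rightarrow> nat \<Rightarrow> diagram \<Rightarrow> complex" where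
  "diagram_weight \<alpha> \<beta> \<gamma> n d = (\<Prod>i\<in>{1..n}. gate_weight \<alpha> \<beta> \<gamma> (fst d i))"

definition total_weight ::
    "complex \<Rightarrow> complex \<Rightarrow> complex \<Rightarrow> nat \<Rightarrow> nat \<Rightarrow> nat \<Rightarrow> complex" where
  "total_weight \<alpha> \<beta> \<gamma> n a b =
     (\<Sum>d | d \<in> labelled_diagrams n \<and> card (diagram_outputs n d) = a \<and>
            card (diagram_inputs n d) = b.
        diagram_weight \<alpha> \<beta> \<gamma> n d)"

lemma finite_labelled_diagrams: "finite (labelled_diagrams n)"
proof -
  have "UNIV = {D2, X2, XD}"
    using gate.exhaust by blast
  then have fin: "finite (UNIV :: gate set)"
    by (metis finite.emptyI finite_insert)
  have "labelled_diagrams n \<subseteq>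
    (SIGMA g:({1..n} \<rightarrow>\<^sub>E UNIV). Pow (out_slots n g \<times> in_slots n g))"
    by (auto simp: labelled_diagrams_def)
  moreover have "finite \<dots>"
    by (intro finite_SigmaI finite_PiE) (auto simp: fin in_slots_def out_slots_def)
  ultimately show ?thesis
    by (rule finite_subset)
qed

text \<open>Formal power series in \<open>z\<close> (outermost), \<open>u\<close> (middle) and \<open>v\<close> (innermost).\<close>

type_synonym zuv_series = "complex fps fps fps"

definition diagram_gf :: "complex \<Rightarrow> complex \<Rightarrow> complex \<Rightarrow> zuv_series" where
  "diagram_gf \<alpha> \<beta> \<gamma> =
     Abs_fps (\<lambda>n. Abs_fps (\<lambda>a. Abs_fps (\<lambda>b. total_weight \<alpha> \<beta> \<gamma> n a b / fact n)))"

definition var_u :: zuv_series where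
  "var_u = fps_const fps_X"

definition var_v :: zuv_series where
  "var_v = fps_const (fps_const fps_X)"

definition of_zseries :: "complex fps \<Rightarrow> zuv_series" where
  "of_zseries f = Abs_fps (\<lambda>n. fps_const (fps_const (fps_nth f n)))"

definition of_scalar :: "complex \<Rightarrow> zuv_series" where
  "of_scalar c = fps_const (fps_const (fps_const c))"

text \<open>The formal exponential \<open>\<Sum>k. f ^ k / k!\<close>, meaningful only for series without constant
  term in \<open>z\<close>. The library's \<open>fps_exp c\<close> is the series of \<open>exp (c * z)\<close>.\<close>

definition formal_exp :: "zuv_series \<Rightarrow> zuv_series" where
  "formal_exp f = fps_compose (of_zseries (fps_exp 1)) f"

end

theory Submission
  imports Defs
begin

text \<open>
  Read a diagram in the order of its labels. Each gate that is appended has the largest label, so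
  its input slots may be connected to any of the outputs that are still free, and its output
  slots to nothing yet. Appending one input slot therefore either leaves it as an input (a factor
  \<open>v\<close>) or consumes one of the free outputs (the derivative \<open>\<partial>/\<partial>u\<close> counts the choices), and appending
  an output slot is a factor \<open>u\<close>. So \<open>D\<close> acts as \<open>\<partial>/\<partial>u + v\<close> and \<open>X\<close> as multiplication by \<open>u\<close>, which is
  lemma \<open>wiring_gf_Suc\<close>. Summing over the gates gives \<open>P\<^bsub>n+1\<^esub> = L P\<^bsub>n\<^esub>\<close> for the generating
  polynomials \<open>P\<^bsub>n\<^esub>\<close> of the diagrams of size \<open>n\<close>, where
  \<open>L = \<alpha> (\<partial>/\<partial>u + v)\<^sup>2 + \<beta> u\<^sup>2 + \<gamma> u (\<partial>/\<partial>u + v)\<close> (lemma \<open>size_gf_Suc\<close>). Hence \<open>G\<close> is the only power series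
  in \<open>z\<close> with \<open>\<partial>G/\<partial>z = L G\<close> and constant term \<open>1\<close> (lemma \<open>evolution_unique\<close>).

  The right-hand side of the theorem has the Gaussian shape
  \<open>exp ((u\<^sup>2/(4\<alpha>) + v\<^sup>2/(4\<beta>)) A + u v B) T\<close> with \<open>A, B, T\<close> depending on \<open>z\<close> only. On such a series the
  operator \<open>\<partial>/\<partial>u + v\<close> acts as multiplication by \<open>w = u A/(2\<alpha>) + v (B + 1)\<close>, and a second application
  adds \<open>\<partial>w/\<partial>u = A/(2\<alpha>)\<close>. Comparing the coefficients of \<open>u\<^sup>2\<close>, \<open>u v\<close>, \<open>v\<^sup>2\<close> and \<open>1\<close> turns
  the evolution equation into the system
  \<open>A' = 4\<alpha>\<beta> + 2\<gamma>A + A\<^sup>2\<close>, \<open>B' = (B + 1)(A + \<gamma>)\<close>, \<open>A' = 4\<alpha>\<beta>(B + 1)\<^sup>2\<close>, \<open>T' = T A/2\<close>.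
  The series of the theorem solve it: \<open>A + \<gamma>\<close> is \<open>\<delta>\<close> times a tangent, \<open>B + 1\<close> is the matching secant
  normalised by \<open>cos \<theta>\<close>, and \<open>\<theta>\<close> is chosen so that \<open>A\<close> vanishes at \<open>0\<close> and
  \<open>4\<alpha>\<beta> cos\<^sup>2 \<theta> = \<delta>\<^sup>2\<close> (lemma \<open>trigonometric_series\<close>).
\<close>

unbundle no vec_syntax

section \<open>Generating polynomials of partial matchings\<close>

definition matchings :: "('a \<times> 'b) set \<Rightarrow> ('a \<times> 'b) set set" where
  "matchings R = {C. C \<subseteq> R \<and> inj_on fst C \<and> inj_on snd C}"

text \<open>Polynomials in \<open>u\<close> and \<open>v\<close> are kept as power series in \<open>u\<close> over power series in \<open>v\<close>,
  the ring of the \<open>z\<close>-coefficients of the diagram series.\<close>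

abbreviation U :: "complex fps fps" where "U \<equiv> fps_X"
abbreviation V :: "complex fps fps" where "V \<equiv> fps_const fps_X"

text \<open>\<open>P\<close> holds the output slots, \<open>Q\<close> the input slots and \<open>R\<close> the admissible connections;
  \<open>u\<close> and \<open>v\<close> mark the slots left unmatched.\<close>

definition matching_gf :: "'a set \<Rightarrow> 'b set \<Rightarrow> ('a \<times> 'b) set \<Rightarrow> complex fps fps" where
  "matching_gf P Q R = (\<Sum>C\<in>matchings R. U ^ card (P - fst ` C) * V ^ card (Q - snd ` C))"

lemma finite_matchings: "finite R \<Longrightarrow> finite (matchings R)"
  unfolding matchings_def by (rule finite_subset[of _ "Pow R"]) auto

lemma matching_gf_add_unusable_output:
  assumes "finite P" "p \<notin> P" "fst ` R \<subseteq> P"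
  shows "matching_gf (insert p P) Q R = U * matching_gf P Q R"
proof -
  have "card (insert p P - fst ` C) = Suc (card (P - fst ` C))" if "C \<in> matchings R" for C
  proof -
    have "insert p P - fst ` C = insert p (P - fst ` C)"
      using that assms by (auto simp: matchings_def)
    then show ?thesis using assms by simp
  qed
  then show ?thesis
    unfolding matching_gf_def sum_distrib_left
    by (intro sum.cong refl) (simp add: mult.assoc)
qed

text \<open>When a new input \<open>q\<close> may be connected to every output, the matchings that use \<open>q\<close> arise
  uniquely from a matching of the old slots by choosing one of its free outputs.\<close>

lemma matchings_add_input:
  assumes "q \<notin> Q" "R \<subseteq> P \<times> Q"
  shows "matchings (R \<union> P \<times> {q}) =
    matchings R \<union> (\<lambda>(C, p). insert (p, q) C) ` (SIGMA C:matchings R. P - fst ` C)"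
    (is "?L = ?M \<union> ?N")
proof (intro equalityI subsetI)
  fix C assume C: "C \<in> ?L"
  show "C \<in> ?M \<union> ?N"
  proof (cases "\<exists>p. (p, q) \<in> C")
    case False
    then show ?thesis using C by (auto simp: matchings_def)
  next
    case True
    then obtain p where p: "(p, q) \<in> C" by blast
    define C' where "C' = C - {(p, q)}"
    have CC: "C = insert (p, q) C'" using p by (auto simp: C'_def)
    have uniq: "p' = p" if "(p', q) \<in> C" for p'
      using C p that by (force simp: matchings_def inj_on_def)
    have "C' \<subseteq> R" using C uniq by (auto simp: C'_def matchings_def)
    moreover have "inj_on fst C'" "inj_on snd C'"
      using C by (auto simp: C'_def matchings_def intro: inj_on_subset)
    moreover have "p \<in> P" using C p assms by (auto simp: matchings_def)
    moreover have "p \<notin> fst ` C'"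
      using C p by (force simp: C'_def matchings_def inj_on_def)
    ultimately have "(C', p) \<in> (SIGMA C:matchings R. P - fst ` C)"
      by (auto simp: matchings_def)
    then show ?thesis using CC by force
  qed
next
  fix C assume "C \<in> ?M \<union> ?N"
  then show "C \<in> ?L"
  proof
    assume "C \<in> ?M" then show ?thesis by (auto simp: matchings_def)
  next
    assume "C \<in> ?N"
    then obtain C' p where *: "C = insert (p, q) C'" "C' \<in> matchings R" "p \<in> P" "p \<notin> fst ` C'"
      by auto
    have "q \<notin> snd ` C'" using * assms by (auto simp: matchings_def)
    then show ?thesis using * by (auto simp: matchings_def)
  qed
qed

lemma fps_deriv_const_power [simp]: "fps_deriv (V ^ m) = 0"
  by (simp add: fps_deriv_power)

text \<open>The analogue of \<open>D X\<^sup>a D\<^sup>b = X\<^sup>a D\<^bsup>b+1\<^esup> + a X\<^bsup>a-1\<^esup> D\<^sup>b\<close>: the factor \<open>a\<close> is the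
  number of free outputs that the new input can consume.\<close>

lemma matching_gf_add_input:
  assumes fin: "finite P" "finite Q" and q: "q \<notin> Q" and R: "R \<subseteq> P \<times> Q"
  shows "matching_gf P (insert q Q) (R \<union> P \<times> {q}) =
    fps_deriv (matching_gf P Q R) + V * matching_gf P Q R"
proof -
  let ?t = "\<lambda>C. U ^ card (P - fst ` C) * V ^ card (insert q Q - snd ` C)"
  let ?S = "SIGMA C:matchings R. P - fst ` C"
  let ?f = "\<lambda>(C, p). insert (p, q) C"
  have "finite R" using R fin by (meson finite_SigmaI finite_subset)
  then have finM: "finite (matchings R)" by (rule finite_matchings)
  have finS: "finite ?S" using finM fin by auto
  have noq: "(p, q) \<notin> C" if "C \<in> matchings R" for C p
    using that R q by (auto simp: matchings_def)
  have noq': "q \<notin> snd ` C" if "C \<in> matchings R" for C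
    using that R q by (auto simp: matchings_def)
  have disj: "matchings R \<inter> ?f ` ?S = {}"
    using noq by auto
  have inj: "inj_on ?f ?S"
  proof (rule inj_onI, clarsimp)
    fix C p C' p'
    assume *: "C \<in> matchings R" "C' \<in> matchings R" "insert (p, q) C = insert (p', q) C'"
    then have "p = p'" using noq by (metis insertE insertI1 prod.inject)
    moreover have "C = C'" using * noq calculation by (metis insert_ident)
    ultimately show "C = C' \<and> p = p'" by simp
  qed
  have old: "?t C = V * (U ^ card (P - fst ` C) * V ^ card (Q - snd ` C))"
    if "C \<in> matchings R" for C
  proof -
    have "insert q Q - snd ` C = insert q (Q - snd ` C)"
      using noq'[OF that] by auto
    then show ?thesis using fin q by (simp add: mult_ac)
  qed
  have new: "(\<Sum>p\<in>P - fst ` C. ?t (insert (p, q) C)) =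
      fps_deriv (U ^ card (P - fst ` C) * V ^ card (Q - snd ` C))" (is "?lhs = _")
    if C: "C \<in> matchings R" for C
  proof -
    have "?t (insert (p, q) C) =
        U ^ (card (P - fst ` C) - 1) * V ^ card (Q - snd ` C)" if "p \<in> P - fst ` C" for p
    proof -
      have "P - fst ` insert (p, q) C = (P - fst ` C) - {p}" by auto
      moreover have "insert q Q - snd ` insert (p, q) C = Q - snd ` C" using q by auto
      ultimately show ?thesis using that fin by simp
    qed
    then have "?lhs = of_nat (card (P - fst ` C)) *
        (U ^ (card (P - fst ` C) - 1) * V ^ card (Q - snd ` C))"
      by simp
    also have "\<dots> = fps_deriv (U ^ card (P - fst ` C) * V ^ card (Q - snd ` C))"
      by (simp add: fps_deriv_power fps_of_nat)
    finally show ?thesis .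
  qed
  have "matching_gf P (insert q Q) (R \<union> P \<times> {q}) =
      (\<Sum>C\<in>matchings R. ?t C) + (\<Sum>C\<in>?f ` ?S. ?t C)"
    unfolding matching_gf_def matchings_add_input[OF q R]
    using disj finM finS by (intro sum.union_disjoint) auto
  also have "(\<Sum>C\<in>?f ` ?S. ?t C) = (\<Sum>(C, p)\<in>?S. ?t (insert (p, q) C))"
    by (subst sum.reindex[OF inj]) (simp add: case_prod_unfold)
  also have "\<dots> = (\<Sum>C\<in>matchings R. \<Sum>p\<in>P - fst ` C. ?t (insert (p, q) C))"
    using finM fin by (subst sum.Sigma) auto
  also have "\<dots> = fps_deriv (matching_gf P Q R)"
    unfolding matching_gf_def fps_deriv_sum by (intro sum.cong refl new)
  also have "(\<Sum>C\<in>matchings R. ?t C) = V * matching_gf P Q R"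
    unfolding matching_gf_def sum_distrib_left by (intro sum.cong refl old)
  finally show ?thesis by (simp add: add.commute)
qed

section \<open>Appending the last gate of a diagram\<close>

text \<open>The effect of a left factor \<open>D\<close> on a normally ordered polynomial in \<open>X\<close> and \<open>D\<close>, with
  \<open>u\<close> and \<open>v\<close> in place of \<open>X\<close> and \<open>D\<close>.\<close>

definition annihilate :: "complex fps fps \<Rightarrow> complex fps fps" where
  "annihilate F = fps_deriv F + V * F"

fun gate_action :: "gate \<Rightarrow> complex fps fps \<Rightarrow> complex fps fps" where
  "gate_action D2 F = annihilate (annihilate F)"
| "gate_action X2 F = U * (U * F)"
| "gate_action XD F = U * annihilate F"

definition forward_pairs :: "nat \<Rightarrow> (nat \<Rightarrow> gate) \<Rightarrow> (slot \<times> slot) set" where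
  "forward_pairs n g = {(p, q) \<in> out_slots n g \<times> in_slots n g. fst p < fst q}"

definition wiring_gf :: "nat \<Rightarrow> (nat \<Rightarrow> gate) \<Rightarrow> complex fps fps" where
  "wiring_gf n g = matching_gf (out_slots n g) (in_slots n g) (forward_pairs n g)"

lemma finite_slots [simp]: "finite (out_slots n g)" "finite (in_slots n g)"
  by (auto simp: out_slots_def in_slots_def)

lemma out_slots_Suc:
  "out_slots (Suc n) (g(Suc n := x)) = out_slots n g \<union> {Suc n} \<times> {..<num_out x}"
  by (auto simp: out_slots_def le_Suc_eq split: if_splits)

lemma in_slots_Suc:
  "in_slots (Suc n) (g(Suc n := x)) = in_slots n g \<union> {Suc n} \<times> {..<num_in x}"
  by (auto simp: in_slots_def le_Suc_eq split: if_splits)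

lemma fresh_slots [simp]: "(Suc n, k) \<notin> out_slots n g" "(Suc n, k) \<notin> in_slots n g"
  by (auto simp: out_slots_def in_slots_def)

text \<open>The new gate has the largest label, so it gains connections through its inputs only, and
  through these to every earlier output.\<close>

lemma forward_pairs_Suc:
  "forward_pairs (Suc n) (g(Suc n := x)) =
     forward_pairs n g \<union> out_slots n g \<times> ({Suc n} \<times> {..<num_in x})"
  unfolding forward_pairs_def out_slots_Suc in_slots_Suc
  by (auto simp: out_slots_def in_slots_def)

text \<open>The slots of the new gate are added one at a time, the inputs before the outputs. This order
  matters for the \<open>XD\<close>-gate: its output must not be available to its own input, which is why the
  action is \<open>u (\<partial>/\<partial>u + v)\<close> and not \<open>(\<partial>/\<partial>u + v) u\<close>.\<close>

lemma wiring_gf_Suc: "wiring_gf (Suc n) (g(Suc n := x)) = gate_action x (wiring_gf n g)"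
proof -
  define P where "P = out_slots n g"
  define Q where "Q = in_slots n g"
  define R where "R = forward_pairs n g"
  let ?s = "\<lambda>k. (Suc n, k) :: slot"
  have fin: "finite P" "finite Q" and fresh: "?s k \<notin> P" "?s k \<notin> Q" for k
    by (simp_all add: P_def Q_def)
  have R: "R \<subseteq> P \<times> Q" by (auto simp: R_def P_def Q_def forward_pairs_def)
  have D: "matching_gf P (insert (?s 0) Q) (R \<union> P \<times> {?s 0}) = annihilate (matching_gf P Q R)"
    unfolding annihilate_def using fin fresh R by (intro matching_gf_add_input) auto
  have new: "wiring_gf (Suc n) (g(Suc n := x)) =
      matching_gf (P \<union> {Suc n} \<times> {..<num_out x}) (Q \<union> {Suc n} \<times> {..<num_in x})
        (R \<union> P \<times> ({Suc n} \<times> {..<num_in x}))"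
    unfolding wiring_gf_def P_def Q_def R_def
    by (simp only: out_slots_Suc in_slots_Suc forward_pairs_Suc)
  have slots: "{Suc n} \<times> {..<0::nat} = {}" "{Suc n} \<times> {..<1::nat} = {?s 0}"
      "{Suc n} \<times> {..<2::nat} = {?s 0, ?s 1}"
    by auto
  have old: "wiring_gf n g = matching_gf P Q R"
    by (simp add: wiring_gf_def P_def Q_def R_def)
  show ?thesis
  proof (cases x)
    case D2
    have "matching_gf P (insert (?s 1) (insert (?s 0) Q)) ((R \<union> P \<times> {?s 0}) \<union> P \<times> {?s 1}) =
        annihilate (matching_gf P (insert (?s 0) Q) (R \<union> P \<times> {?s 0}))"
      unfolding annihilate_def using fin fresh R by (intro matching_gf_add_input) auto
    moreover have "(R \<union> P \<times> {?s 0}) \<union> P \<times> {?s 1} = R \<union> P \<times> {?s 0, ?s 1}" by auto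
    ultimately show ?thesis
      unfolding new using D2 D slots by (simp add: old insert_commute)
  next
    case X2
    have "matching_gf (insert (?s 1) (insert (?s 0) P)) Q R =
        U * matching_gf (insert (?s 0) P) Q R"
      using fin fresh R by (intro matching_gf_add_unusable_output) auto
    also have "matching_gf (insert (?s 0) P) Q R = U * matching_gf P Q R"
      using fin fresh R by (intro matching_gf_add_unusable_output) auto
    finally show ?thesis
      unfolding new using X2 slots by (simp add: old insert_commute)
  next
    case XD
    have "matching_gf (insert (?s 0) P) (insert (?s 0) Q) (R \<union> P \<times> {?s 0}) =
        U * matching_gf P (insert (?s 0) Q) (R \<union> P \<times> {?s 0})"
      using fin fresh R by (intro matching_gf_add_unusable_output) auto
    then show ?thesis
      unfolding new using XD D slots by (simp add: old)
  qed
qed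

definition scalar_uv :: "complex \<Rightarrow> complex fps fps" where
  "scalar_uv c = fps_const (fps_const c)"

lemma scalar_uv_simps [simp]:
  "scalar_uv (a * b) = scalar_uv a * scalar_uv b" "scalar_uv 1 = 1" "fps_deriv (scalar_uv a) = 0"
  by (simp_all add: scalar_uv_def)

definition operator_action ::
    "complex \<Rightarrow> complex \<Rightarrow> complex \<Rightarrow> complex fps fps \<Rightarrow> complex fps fps" where
  "operator_action \<alpha> \<beta> \<gamma> F = scalar_uv \<alpha> * annihilate (annihilate F) +
     scalar_uv \<beta> * (U * (U * F)) + scalar_uv \<gamma> * (U * annihilate F)"

definition size_gf :: "complex \<Rightarrow> complex \<Rightarrow> complex \<Rightarrow> nat \<Rightarrow> complex fps fps" where
  "size_gf \<alpha> \<beta> \<gamma> n = (\<Sum>g\<in>{1..n} \<rightarrow>\<^sub>E UNIV.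
     scalar_uv (\<Prod>i\<in>{1..n}. gate_weight \<alpha> \<beta> \<gamma> (g i)) * wiring_gf n g)"

lemma UNIV_gate: "(UNIV :: gate set) = {D2, X2, XD}"
  using gate.exhaust by blast

lemma sum_UNIV_gate: "sum h (UNIV :: gate set) = h D2 + h X2 + h XD"
  for h :: "gate \<Rightarrow> 'a::comm_monoid_add"
  by (simp add: UNIV_gate add.assoc)

lemma finite_UNIV_gate [simp]: "finite (UNIV :: gate set)"
  by (simp add: UNIV_gate)

lemma monom_nth: "(scalar_uv c * (U ^ i * V ^ j)) $ a $ b = (if i = a \<and> j = b then c else 0)"
  by (auto simp: scalar_uv_def fps_X_power_mult_nth)

lemma labelled_diagrams_eq_Sigma:
  "labelled_diagrams n = (SIGMA g:{1..n} \<rightarrow>\<^sub>E UNIV. matchings (forward_pairs n g))"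
  by (auto simp: labelled_diagrams_def matchings_def forward_pairs_def)

lemma size_gf_nth: "size_gf \<alpha> \<beta> \<gamma> n $ a $ b = total_weight \<alpha> \<beta> \<gamma> n a b"
proof -
  let ?w = "diagram_weight \<alpha> \<beta> \<gamma> n"
  have fin: "finite ({1..n} \<rightarrow>\<^sub>E (UNIV :: gate set))" by (intro finite_PiE) auto
  have finR: "finite (forward_pairs n g)" for g
    by (rule finite_subset[of _ "out_slots n g \<times> in_slots n g"]) (auto simp: forward_pairs_def)
  have "size_gf \<alpha> \<beta> \<gamma> n = (\<Sum>d\<in>labelled_diagrams n.
      scalar_uv (?w d) * (U ^ card (diagram_outputs n d) * V ^ card (diagram_inputs n d)))"
    unfolding size_gf_def wiring_gf_def matching_gf_def labelled_diagrams_eq_Sigma sum_distrib_left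
    by (subst sum.Sigma)
       (auto simp: fin finR finite_matchings diagram_weight_def diagram_outputs_def
          diagram_inputs_def intro!: sum.cong finite_PiE)
  also have "\<dots> $ a $ b = (\<Sum>d\<in>labelled_diagrams n.
      if card (diagram_outputs n d) = a \<and> card (diagram_inputs n d) = b then ?w d else 0)"
    by (simp only: fps_sum_nth monom_nth)
  also have "\<dots> = total_weight \<alpha> \<beta> \<gamma> n a b"
    unfolding total_weight_def
    by (simp add: finite_labelled_diagrams sum.inter_filter)
  finally show ?thesis .
qed

lemma annihilate_add: "annihilate (F + G) = annihilate F + annihilate G"
  by (simp add: annihilate_def algebra_simps)

lemma annihilate_mult_const: "fps_deriv c = 0 \<Longrightarrow> annihilate (c * F) = c * annihilate F"
  by (simp add: annihilate_def algebra_simps)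

lemma operator_action_mult_const:
  "fps_deriv c = 0 \<Longrightarrow> operator_action \<alpha> \<beta> \<gamma> (c * F) = c * operator_action \<alpha> \<beta> \<gamma> F"
  unfolding operator_action_def
  by (simp only: annihilate_mult_const) (simp only: distrib_left mult.left_commute)

lemma operator_action_sum:
  "operator_action \<alpha> \<beta> \<gamma> (sum F A) = (\<Sum>x\<in>A. operator_action \<alpha> \<beta> \<gamma> (F x))"
proof (induction A rule: infinite_finite_induct)
  case (insert x A)
  have "operator_action \<alpha> \<beta> \<gamma> (G + H) = operator_action \<alpha> \<beta> \<gamma> G + operator_action \<alpha> \<beta> \<gamma> H" for G H
    by (simp add: operator_action_def annihilate_add algebra_simps)
  with insert show ?case by simp
qed (simp_all add: operator_action_def annihilate_def)

lemma size_gf_0: "size_gf \<alpha> \<beta> \<gamma> 0 = 1"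
proof -
  have "matchings {} = {{} :: (slot \<times> slot) set}" by (auto simp: matchings_def)
  then show ?thesis
    by (simp add: size_gf_def wiring_gf_def matching_gf_def forward_pairs_def out_slots_def in_slots_def)
qed

lemma size_gf_Suc: "size_gf \<alpha> \<beta> \<gamma> (Suc n) = operator_action \<alpha> \<beta> \<gamma> (size_gf \<alpha> \<beta> \<gamma> n)"
proof -
  let ?G = "{1..n} \<rightarrow>\<^sub>E (UNIV :: gate set)"
  let ?W = "\<lambda>n g. scalar_uv (\<Prod>i\<in>{1..n}. gate_weight \<alpha> \<beta> \<gamma> (g i))"
  have interval: "{1..Suc n} = insert (Suc n) {1..n}" by auto
  have weight: "?W (Suc n) (g(Suc n := x)) = scalar_uv (gate_weight \<alpha> \<beta> \<gamma> x) * ?W n g" for x g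
  proof -
    have "(\<Prod>i\<in>{1..n}. gate_weight \<alpha> \<beta> \<gamma> ((g(Suc n := x)) i)) = (\<Prod>i\<in>{1..n}. gate_weight \<alpha> \<beta> \<gamma> (g i))"
      by (intro prod.cong) auto
    then show ?thesis unfolding interval by simp
  qed
  have appended: "?W (Suc n) (g(Suc n := x)) * wiring_gf (Suc n) (g(Suc n := x)) =
      scalar_uv (gate_weight \<alpha> \<beta> \<gamma> x) * gate_action x (?W n g * wiring_gf n g)" for x g
  proof -
    have "gate_action x (?W n g * wiring_gf n g) = ?W n g * gate_action x (wiring_gf n g)"
      by (cases x) (simp_all only: gate_action.simps annihilate_mult_const scalar_uv_simps mult.left_commute)
    then show ?thesis unfolding weight wiring_gf_Suc by (simp only: mult_ac)
  qed
  have "size_gf \<alpha> \<beta> \<gamma> (Suc n) =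
      (\<Sum>(x, g)\<in>UNIV \<times> ?G. ?W (Suc n) (g(Suc n := x)) * wiring_gf (Suc n) (g(Suc n := x)))"
    unfolding size_gf_def
    by (subst interval, subst PiE_insert_eq, subst sum.reindex[OF inj_combinator])
       (simp_all add: case_prod_unfold)
  also have "\<dots> = (\<Sum>(x, g)\<in>UNIV \<times> ?G.
      scalar_uv (gate_weight \<alpha> \<beta> \<gamma> x) * gate_action x (?W n g * wiring_gf n g))"
    by (simp only: appended)
  also have "\<dots> = (\<Sum>g\<in>?G. operator_action \<alpha> \<beta> \<gamma> (?W n g * wiring_gf n g))"
    unfolding sum.cartesian_product[symmetric]
    by (subst sum.swap)
       (simp only: sum_UNIV_gate gate_weight.simps gate_action.simps operator_action_def)
  also have "\<dots> = operator_action \<alpha> \<beta> \<gamma> (size_gf \<alpha> \<beta> \<gamma> n)"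
    by (simp add: size_gf_def operator_action_sum)
  finally show ?thesis .
qed

section \<open>The evolution equation\<close>

definition deriv_u :: "zuv_series \<Rightarrow> zuv_series" where
  "deriv_u F = Abs_fps (\<lambda>n. fps_deriv (F $ n))"

lemma deriv_u_simps [simp]:
  "deriv_u (F + G) = deriv_u F + deriv_u G"
  "deriv_u (F - G) = deriv_u F - deriv_u G"
  "deriv_u (F * G) = deriv_u F * G + F * deriv_u G"
  "deriv_u 1 = 0" "deriv_u var_u = 1" "deriv_u var_v = 0"
  "deriv_u (of_scalar c) = 0" "deriv_u (of_zseries f) = 0"
proof -
  show "deriv_u (F * G) = deriv_u F * G + F * deriv_u G"
    by (rule fps_ext)
       (simp add: deriv_u_def fps_mult_nth fps_deriv_sum sum.distrib add.commute)
qed (auto simp: deriv_u_def fps_eq_iff var_u_def var_v_def of_scalar_def of_zseries_def)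

lemma fps_deriv_deriv_u: "fps_deriv (deriv_u F) = deriv_u (fps_deriv F)"
  by (rule fps_ext) (simp add: deriv_u_def fps_of_nat)

definition annihilate_z :: "zuv_series \<Rightarrow> zuv_series" where
  "annihilate_z F = deriv_u F + var_v * F"

text \<open>The coefficient of \<open>z\<^sup>n\<close> in the evolution equation expresses the coefficient of \<open>z\<^bsup>n+1\<^esup>\<close>
  through that of \<open>z\<^sup>n\<close>, so the constant term determines a solution; up to the factors \<open>n!\<close> this
  recurrence is \<open>size_gf_Suc\<close>.\<close>

lemma evolution_unique:
  assumes "F $ 0 = 1"
    and "fps_deriv F = of_scalar \<alpha> * annihilate_z (annihilate_z F) +
      of_scalar \<beta> * (var_u * (var_u * F)) + of_scalar \<gamma> * (var_u * annihilate_z F)"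
  shows "F = diagram_gf \<alpha> \<beta> \<gamma>"
proof -
  have ann: "annihilate_z H $ n = annihilate (H $ n)" for H n
    by (simp add: annihilate_z_def annihilate_def deriv_u_def var_v_def)
  have step: "of_nat (Suc n) * F $ Suc n = operator_action \<alpha> \<beta> \<gamma> (F $ n)" for n
    using arg_cong[OF assms(2), of "\<lambda>H. H $ n"]
    by (simp add: ann operator_action_def of_scalar_def var_u_def scalar_uv_def)
  have "of_nat (fact n) * F $ n = size_gf \<alpha> \<beta> \<gamma> n" for n
  proof (induction n)
    case 0
    then show ?case by (simp add: assms size_gf_0)
  next
    case (Suc n)
    have "of_nat (fact (Suc n)) * F $ Suc n = of_nat (fact n) * (of_nat (Suc n) * F $ Suc n)"
      by (simp only: fact_Suc of_nat_mult of_nat_id mult_ac)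
    also have "\<dots> = operator_action \<alpha> \<beta> \<gamma> (of_nat (fact n) * F $ n)"
      unfolding step by (rule operator_action_mult_const[OF fps_deriv_of_nat, symmetric])
    finally show ?case by (simp only: Suc size_gf_Suc)
  qed
  then have "(of_nat (fact n) * F $ n) $ a $ b = total_weight \<alpha> \<beta> \<gamma> n a b" for n a b
    by (simp only: size_gf_nth)
  then have "fact n * (F $ n $ a $ b) = total_weight \<alpha> \<beta> \<gamma> n a b" for n a b
    unfolding fps_mult_of_nat_nth by simp
  then show ?thesis
    by (intro fps_ext) (simp add: diagram_gf_def field_simps)
qed

section \<open>Formal exponentials\<close>

lemma of_zseries_simps [simp]:
  "of_zseries (f + g) = of_zseries f + of_zseries g"
  "of_zseries (f * g) = of_zseries f * of_zseries g"
  "of_zseries (fps_const c) = of_scalar c"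
  "of_zseries 1 = 1"
  by (auto simp: of_zseries_def of_scalar_def fps_eq_iff fps_mult_nth fps_sum_nth)

lemma fps_deriv_of_zseries: "fps_deriv (of_zseries f) = of_zseries (fps_deriv f)"
  by (rule fps_ext) (simp add: of_zseries_def flip: fps_of_nat)

lemma formal_exp_nth_0: "formal_exp f $ 0 = 1"
  by (simp add: formal_exp_def fps_compose_nth of_zseries_def)

lemma fps_deriv_formal_exp:
  assumes "f $ 0 = 0"
  shows "fps_deriv (formal_exp f) = formal_exp f * fps_deriv f"
  unfolding formal_exp_def by (simp add: fps_compose_deriv assms fps_deriv_of_zseries)

lemma linear_ode_zero:
  fixes Y K :: zuv_series
  assumes "fps_deriv Y = Y * K" "Y $ 0 = 0"
  shows "Y = 0"
proof -
  have "Y $ n = 0" for n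
  proof (induction n rule: less_induct)
    case (less n)
    show ?case
    proof (cases n)
      case (Suc m)
      have "of_nat (Suc m) * Y $ Suc m = (\<Sum>i=0..m. Y $ i * K $ (m - i))"
        using arg_cong[OF assms(1), of "\<lambda>H. H $ m"] by (simp add: fps_mult_nth)
      also have "\<dots> = 0" using less Suc by (intro sum.neutral) auto
      finally show ?thesis unfolding Suc by (metis mult_eq_0_iff of_nat_neq_0)
    qed (use assms in simp)
  qed
  then show ?thesis by (simp add: fps_eq_iff)
qed

text \<open>The chain rule for \<open>\<partial>/\<partial>u\<close> is not an instance of the one for \<open>\<partial>/\<partial>z\<close>, the variable in which the
  exponential is composed. But both sides satisfy the same inhomogeneous linear equation in \<open>z\<close>, since
  \<open>\<partial>/\<partial>u\<close> and \<open>\<partial>/\<partial>z\<close> commute, so their difference \<open>Y\<close> solves \<open>Y' = Y f'\<close> with \<open>Y(0) = 0\<close>.\<close>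

lemma deriv_u_formal_exp:
  assumes "f $ 0 = 0"
  shows "deriv_u (formal_exp f) = formal_exp f * deriv_u f"
proof -
  let ?E = "formal_exp f" and ?Y = "deriv_u (formal_exp f) - formal_exp f * deriv_u f"
  have "fps_deriv ?Y = ?Y * fps_deriv f"
    by (simp add: fps_deriv_deriv_u fps_deriv_formal_exp[OF assms] algebra_simps)
  moreover have "?Y $ 0 = 0"
    by (simp add: deriv_u_def formal_exp_nth_0 assms)
  ultimately show ?thesis using linear_ode_zero by fastforce
qed

section \<open>The trigonometric coefficients\<close>

text \<open>The identities hold for the analytic functions wherever \<open>cos (\<delta> z + \<theta>) \<noteq> 0\<close>, in
  particular near \<open>0\<close>, and pass to the expansions by uniqueness. The condition \<open>\<alpha>\<beta> \<noteq> 0\<close> says that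
  \<open>\<gamma>/\<delta> \<noteq> \<plusminus>\<i>\<close>, the two values that the tangent omits. The equation for \<open>S\<close> comes from
  \<open>S\<^sup>2 = B + 1\<close> by differentiating and cancelling \<open>S\<close>.\<close>

lemma trigonometric_series:
  fixes \<alpha> \<beta> \<gamma> \<delta> \<theta> :: complex
  assumes "\<alpha> * \<beta> \<noteq> 0"
    and "4 * \<alpha> * \<beta> \<noteq> \<gamma>\<^sup>2"
    and "\<delta>\<^sup>2 = 4 * \<alpha> * \<beta> - \<gamma>\<^sup>2"
    and "\<theta> = Arctan (\<gamma> / \<delta>)"
  defines "A \<equiv> fps_expansion (\<lambda>z. \<delta> * tan (\<delta> * z + \<theta>) - \<gamma>) 0"
    and "B \<equiv> fps_expansion (\<lambda>z. cos \<theta> / cos (\<delta> * z + \<theta>) - 1) 0"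
    and "S \<equiv> fps_expansion (\<lambda>z. csqrt (cos \<theta> / cos (\<delta> * z + \<theta>))) 0"
  shows "A $ 0 = 0" "B $ 0 = 0" "S $ 0 = 1"
    and "fps_deriv A = fps_const (4 * \<alpha> * \<beta>) + fps_const (2 * \<gamma>) * A + A * A"
    and "fps_deriv B = (B + 1) * (A + fps_const \<gamma>)"
    and "fps_const (4 * \<alpha> * \<beta>) * ((B + 1) * (B + 1)) = fps_deriv A"
    and "fps_const 2 * fps_deriv S = S * (A + fps_const \<gamma>)"
proof -
  have d0: "\<delta> \<noteq> 0" using assms(2,3) by auto
  have tan\<theta>: "tan \<theta> = \<gamma> / \<delta>"
  proof -
    have "(\<gamma> / \<delta>)\<^sup>2 \<noteq> -1"
    proof
      assume "(\<gamma> / \<delta>)\<^sup>2 = -1"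
      then have "\<gamma>\<^sup>2 = - \<delta>\<^sup>2" using d0 by (simp add: field_simps)
      then show False using assms(1,3) by simp
    qed
    then show ?thesis using assms(4) tan_Arctan by simp
  qed
  have c0: "cos \<theta> \<noteq> 0"
  proof
    assume "cos \<theta> = 0"
    \<comment> \<open>Division by zero gives \<open>0\<close>, so the tangent would vanish and force \<open>\<theta> = 0\<close>.\<close>
    then have "\<gamma> = 0" using tan\<theta> d0 by (simp add: tan_def)
    then have "\<theta> = 0" using assms(4) by simp
    with \<open>cos \<theta> = 0\<close> show False by simp
  qed
  have cos2: "4 * \<alpha> * \<beta> * (cos \<theta>)\<^sup>2 = \<delta>\<^sup>2"
  proof -
    have "\<delta> * sin \<theta> = \<gamma> * cos \<theta>" using tan\<theta> c0 d0 by (simp add: tan_def field_simps)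
    then have "\<delta>\<^sup>2 * (sin \<theta>)\<^sup>2 = \<gamma>\<^sup>2 * (cos \<theta>)\<^sup>2" by (metis power_mult_distrib)
    then have "\<delta>\<^sup>2 * (1 - (cos \<theta>)\<^sup>2) = \<gamma>\<^sup>2 * (cos \<theta>)\<^sup>2" by (simp add: sin_squared_eq)
    then have "\<delta>\<^sup>2 = (\<gamma>\<^sup>2 + \<delta>\<^sup>2) * (cos \<theta>)\<^sup>2" by (simp add: algebra_simps)
    then show ?thesis using assms(3) by simp
  qed
  define a where "a = (\<lambda>z. \<delta> * tan (\<delta> * z + \<theta>) - \<gamma>)"
  define b where "b = (\<lambda>z. cos \<theta> / cos (\<delta> * z + \<theta>) - 1)"
  define s where "s = (\<lambda>z. csqrt (cos \<theta> / cos (\<delta> * z + \<theta>)))"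
  have ana: "a analytic_on {0}" unfolding a_def by (intro analytic_intros) (use c0 in auto)
  have anb: "b analytic_on {0}" unfolding b_def by (intro analytic_intros) (use c0 in auto)
  have ans: "s analytic_on {0}" unfolding s_def by (intro analytic_intros) (use c0 in auto)
  have A: "a has_fps_expansion A" unfolding A_def a_def[symmetric]
    by (rule analytic_at_imp_has_fps_expansion_0[OF ana])
  have B: "b has_fps_expansion B" unfolding B_def b_def[symmetric]
    by (rule analytic_at_imp_has_fps_expansion_0[OF anb])
  have S: "s has_fps_expansion S" unfolding S_def s_def[symmetric]
    by (rule analytic_at_imp_has_fps_expansion_0[OF ans])
  show "A $ 0 = 0" using has_fps_expansion_imp_0_eq_fps_nth_0[OF A] tan\<theta> d0 by (simp add: a_def)
  show "B $ 0 = 0" using has_fps_expansion_imp_0_eq_fps_nth_0[OF B] c0 by (simp add: b_def)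
  show S0: "S $ 0 = 1" using has_fps_expansion_imp_0_eq_fps_nth_0[OF S] c0 by (simp add: s_def)
  have ev: "eventually (\<lambda>z. cos (\<delta> * z + \<theta>) \<noteq> 0) (nhds 0)"
  proof -
    have "open {z. cos (\<delta> * z + \<theta>) \<noteq> 0}"
      by (intro open_Collect_neq continuous_intros)
    from eventually_nhds_in_open[OF this, of 0] show ?thesis using c0 by simp
  qed
  have deriv_a: "deriv a z = 4 * \<alpha> * \<beta> + 2 * \<gamma> * a z + a z * a z"
    and deriv_b: "deriv b z = (b z + 1) * (a z + \<gamma>)"
    and b_sq: "4 * \<alpha> * \<beta> * ((b z + 1) * (b z + 1)) = deriv a z"
    if c: "cos (\<delta> * z + \<theta>) \<noteq> 0" for z
  proof -
    have 1: "deriv a z = \<delta>\<^sup>2 / (cos (\<delta> * z + \<theta>))\<^sup>2"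
      unfolding a_def using c
      by (intro DERIV_imp_deriv)
         (auto intro!: derivative_eq_intros simp: power2_eq_square divide_simps)
    have "1 / (cos (\<delta> * z + \<theta>))\<^sup>2 = 1 + (tan (\<delta> * z + \<theta>))\<^sup>2"
      using tan_sec[OF c] by (simp add: inverse_eq_divide power_divide)
    then have "deriv a z = \<delta>\<^sup>2 * (1 + (tan (\<delta> * z + \<theta>))\<^sup>2)"
      unfolding 1 by (metis times_divide_eq_right mult.right_neutral)
    also have "\<dots> = \<delta>\<^sup>2 + (a z + \<gamma>)\<^sup>2"
      by (simp add: a_def algebra_simps power2_eq_square)
    also have "\<dots> = 4 * \<alpha> * \<beta> + 2 * \<gamma> * a z + a z * a z"
      using assms(3) by (simp add: algebra_simps power2_eq_square)
    finally show "deriv a z = 4 * \<alpha> * \<beta> + 2 * \<gamma> * a z + a z * a z" .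
    have "(b has_field_derivative
        cos \<theta> * (\<delta> * sin (\<delta> * z + \<theta>)) / (cos (\<delta> * z + \<theta>) * cos (\<delta> * z + \<theta>))) (at z)"
      unfolding b_def using c by (auto intro!: derivative_eq_intros)
    then show "deriv b z = (b z + 1) * (a z + \<gamma>)"
      by (simp add: DERIV_imp_deriv a_def b_def tan_def)
    show "4 * \<alpha> * \<beta> * ((b z + 1) * (b z + 1)) = deriv a z"
      unfolding 1 cos2[symmetric] by (simp add: b_def power2_eq_square)
  qed
  have uniq: "F = G" if "f has_fps_expansion F" "g has_fps_expansion G"
    "\<And>z. cos (\<delta> * z + \<theta>) \<noteq> 0 \<Longrightarrow> f z = g z" for f g and F G :: "complex fps"
  proof -
    have "eventually (\<lambda>z. f z = g z) (nhds 0)" using ev by eventually_elim (rule that(3))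
    then show ?thesis
      using that(1,2) has_fps_expansion_cong fps_expansion_unique_complex by blast
  qed
  note I = fps_expansion_intros A B S
  show "fps_deriv A = fps_const (4 * \<alpha> * \<beta>) + fps_const (2 * \<gamma>) * A + A * A"
    by (rule uniq[where f = "deriv a" and g = "\<lambda>z. 4 * \<alpha> * \<beta> + 2 * \<gamma> * a z + a z * a z"])
       (intro I | simp add: deriv_a)+
  show dB: "fps_deriv B = (B + 1) * (A + fps_const \<gamma>)"
    by (rule uniq[where f = "deriv b" and g = "\<lambda>z. (b z + 1) * (a z + \<gamma>)"])
       (intro I | simp add: deriv_b)+
  show "fps_const (4 * \<alpha> * \<beta>) * ((B + 1) * (B + 1)) = fps_deriv A"
    by (rule uniq[where g = "deriv a" and f = "\<lambda>z. 4 * \<alpha> * \<beta> * ((b z + 1) * (b z + 1))"])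
       (intro I | simp add: b_sq)+
  have SS: "S * S = B + 1"
    by (rule uniq[where f = "\<lambda>z. s z * s z" and g = "\<lambda>z. b z + 1"])
       (intro I | simp add: s_def b_def flip: power2_eq_square)+
  have "S * (fps_const 2 * fps_deriv S) = fps_deriv (S * S)"
    by (simp add: algebra_simps flip: fps_const_add mult_2)
  also have "\<dots> = S * (S * (A + fps_const \<gamma>))" by (simp add: SS dB flip: mult.assoc)
  finally have "S * (fps_const 2 * fps_deriv S) = S * (S * (A + fps_const \<gamma>))" .
  moreover have "S \<noteq> 0" using S0 by auto
  ultimately show "fps_const 2 * fps_deriv S = S * (A + fps_const \<gamma>)" by simp
qed

theorem proposition9:
  fixes \<alpha> \<beta> \<gamma> \<delta> \<theta> :: complex
  assumes "\<alpha> * \<beta> \<noteq> 0"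
    and "4 * \<alpha> * \<beta> \<noteq> \<gamma>\<^sup>2"
    and "\<delta>\<^sup>2 = 4 * \<alpha> * \<beta> - \<gamma>\<^sup>2"
    and "\<theta> = Arctan (\<gamma> / \<delta>)"
  shows "diagram_gf \<alpha> \<beta> \<gamma> =
    formal_exp
      ((var_u\<^sup>2 * of_scalar (1 / (4 * \<alpha>)) + var_v\<^sup>2 * of_scalar (1 / (4 * \<beta>))) *
       of_zseries (fps_expansion (\<lambda>z. \<delta> * tan (\<delta> * z + \<theta>) - \<gamma>) 0)) *
    formal_exp
      (var_u * var_v *
       of_zseries (fps_expansion (\<lambda>z. cos \<theta> / cos (\<delta> * z + \<theta>) - 1) 0)) *
    of_zseries (fps_exp (- \<gamma> / 2)) *
    of_zseries (fps_expansion (\<lambda>z. csqrt (cos \<theta> / cos (\<delta> * z + \<theta>))) 0)"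
proof -
  define A where "A = fps_expansion (\<lambda>z. \<delta> * tan (\<delta> * z + \<theta>) - \<gamma>) 0"
  define B where "B = fps_expansion (\<lambda>z. cos \<theta> / cos (\<delta> * z + \<theta>) - 1) 0"
  define S where "S = fps_expansion (\<lambda>z. csqrt (cos \<theta> / cos (\<delta> * z + \<theta>))) 0"
  note trig = trigonometric_series[OF assms, folded A_def B_def S_def]
  have nz: "\<alpha> \<noteq> 0" "\<beta> \<noteq> 0" using assms(1) by auto
  define f1 where "f1 = (var_u\<^sup>2 * of_scalar (1 / (4 * \<alpha>)) + var_v\<^sup>2 * of_scalar (1 / (4 * \<beta>))) * of_zseries A"
  define f2 where "f2 = var_u * var_v * of_zseries B"
  define T where "T = of_zseries (fps_exp (- \<gamma> / 2)) * of_zseries S"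
  define F where "F = formal_exp f1 * formal_exp f2 * T"
  have scalar: "of_scalar (x * y) = of_scalar x * of_scalar y"
    "of_scalar (x + y) = of_scalar x + of_scalar y" "of_scalar 1 = 1" "of_scalar 2 = 2" "of_scalar 4 = 4"
    "fps_deriv (of_scalar x) = 0"
    for x y by (simp_all add: of_scalar_def numeral_fps_const)
  have const: "fps_deriv var_u = 0" "fps_deriv var_v = 0"
    by (simp_all add: var_u_def var_v_def)
  have f0: "f1 $ 0 = 0" "f2 $ 0 = 0"
    by (simp_all add: f1_def f2_def of_zseries_def trig)
  have T0: "T $ 0 = 1" by (simp add: T_def of_zseries_def trig)
  have F0: "F $ 0 = 1" by (simp add: F_def formal_exp_nth_0 T0)
  \<comment> \<open>The verification is polynomial algebra over these elements, with \<open>p = 1/(4\<alpha>)\<close> and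
    \<open>q = 1/(4\<beta>)\<close> known only through \<open>4 \<alpha> p = 1\<close> and \<open>4 \<beta> q = 1\<close>.\<close>
  define a b p q c where "a = of_zseries A" and "b = of_zseries B"
    and "p = of_scalar (1 / (4 * \<alpha>))" and "q = of_scalar (1 / (4 * \<beta>))" and "c = of_scalar \<gamma>"
  define x y where "x = of_scalar \<alpha>" and "y = of_scalar \<beta>"
  have a': "fps_deriv a = 4 * x * y + 2 * c * a + a * a"
    by (simp add: a_def x_def y_def c_def fps_deriv_of_zseries trig scalar)
  have b': "fps_deriv b = (b + 1) * (a + c)"
    by (simp add: a_def b_def c_def fps_deriv_of_zseries trig)
  have ab: "4 * x * y * ((b + 1) * (b + 1)) = fps_deriv a"
    using arg_cong[OF trig(6), of of_zseries]
    by (simp add: a_def b_def x_def y_def fps_deriv_of_zseries scalar)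
  have S': "2 * fps_deriv (of_zseries S) = of_zseries S * (a + c)"
    using arg_cong[OF trig(7), of of_zseries]
    by (simp add: a_def c_def fps_deriv_of_zseries scalar)
  have "2 * of_scalar (- \<gamma> / 2) = - c"
    by (simp add: c_def flip: scalar) (simp add: of_scalar_def)
  then have T': "2 * fps_deriv T = T * a"
    using S' by (simp add: T_def fps_deriv_of_zseries) algebra
  have px: "4 * x * p = 1" and qy: "4 * y * q = 1"
    using nz by (simp_all add: x_def y_def p_def q_def flip: scalar)
  have "deriv_u F = F * (deriv_u f1 + deriv_u f2)"
    by (simp add: F_def T_def deriv_u_formal_exp f0 algebra_simps)
  moreover have "deriv_u f1 = 2 * p * var_u * a" "deriv_u f2 = var_v * b"
    by (simp_all add: f1_def f2_def p_def a_def b_def power2_eq_square)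
  moreover define w where "w = 2 * p * var_u * a + var_v * (b + 1)"
  ultimately have ann: "annihilate_z F = F * w"
    by (simp add: annihilate_z_def algebra_simps)
  have "deriv_u w = 2 * p * a"
    by (simp add: w_def a_def b_def p_def algebra_simps flip: scalar)
  moreover have "annihilate_z (F * w) = annihilate_z F * w + F * deriv_u w"
    by (simp add: annihilate_z_def distrib_left distrib_right mult.assoc)
  ultimately have ann2: "annihilate_z (F * w) = F * (w * w + 2 * p * a)"
    unfolding ann by (simp add: algebra_simps)
  have f1': "fps_deriv f1 = (var_u * var_u * p + var_v * var_v * q) * fps_deriv a"
    by (simp add: f1_def p_def q_def a_def const scalar power2_eq_square algebra_simps)
  have f2': "fps_deriv f2 = var_u * var_v * fps_deriv b"
    by (simp add: f2_def b_def const)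
  \<comment> \<open>The logarithmic derivative is doubled because \<open>T' = T A/2\<close> is available only without
    division.\<close>
  have "2 * fps_deriv F = F * (2 * fps_deriv f1 + 2 * fps_deriv f2 + a)"
    using T' by (simp add: F_def fps_deriv_formal_exp f0) algebra
  moreover have "2 * fps_deriv f1 + 2 * fps_deriv f2 + a =
      2 * (x * (w * w + 2 * p * a) + y * var_u * var_u + c * var_u * w)"
    using ab a' b' px qy unfolding f1' f2' w_def by algebra
  ultimately have "2 * fps_deriv F =
      2 * (x * (F * (w * w + 2 * p * a)) + y * (var_u * (var_u * F)) + c * (var_u * (F * w)))"
    by algebra
  moreover have two_neq_0: "(2 :: zuv_series) \<noteq> 0"
    by (simp add: numeral_fps_const)
  ultimately have "fps_deriv F = x * annihilate_z (annihilate_z F) + y * (var_u * (var_u * F)) +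
      c * (var_u * annihilate_z F)"
    unfolding ann ann2 mult_cancel_left using two_neq_0 by blast
  then have "F = diagram_gf \<alpha> \<beta> \<gamma>"
    unfolding x_def y_def c_def by (rule evolution_unique[OF F0])
  then show ?thesis
    by (simp add: F_def T_def f1_def f2_def A_def B_def S_def mult.assoc)
qed

end
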